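(* Let $|\gamma|<1$. Let $c\in\mathfrak D_{\mathcal M_{\theta_\gamma}^*}$ and $c_1\in\mathfrak D_{\mathcal M_{\theta_\gamma}}$ be unit vectors, and let $\Phi_\gamma^*:L^2(\mu)\to\mathcal K_{\theta_\gamma}$ be a unitary operator with $\Phi_\gamma^*U_\gamma=\mathcal M_{\theta_\gamma}\Phi_\gamma^*$, $\Phi_\gamma^*b=c$ and $\Phi_\gamma^*b_1=c_1$. Then for all $f\in C^1(\mathbb T)$, $$\Phi_\gamma^*f(z)=A_\gamma(z)f(z)+B_\gamma(z)\int_{\mathbb T}\frac{f(\xi)-f(z)}{1-\overline\xi z}\,d\mu(\xi)\qquad\text{a.e. }z\in\mathbb T,$$ where $A_\gamma(z)=c(z)$ and $B_\gamma(z)=c(z)-zc_1(z)$.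
   Context: $\mathbb T=\{|z|=1\}$, $\mathbb D$ the open unit disc. Let $\mu$ be a Borel probability measure on $\mathbb T$, $U=M_\xi$ multiplication by the independent variable on $L^2(\mu)$, $b=\mathbf 1$, $b_1=U^*b$ ($b_1(\xi)=\overline\xi$). For $|\gamma|<1$, $U_\gamma=U+(\gamma-1)(\,\cdot\,,b_1)_{L^2(\mu)}b$, a completely non-unitary contraction. For $\lambda\in\mathbb D$ let $R_2\mu(\lambda)=\int_{\mathbb T}\frac{1+\overline\xi\lambda}{1-\overline\xi\lambda}d\mu(\xi)$ and $\theta_\gamma(\lambda)=\frac{(1-\gamma)R_2\mu(\lambda)-(1+\gamma)}{(1-\overline\gamma)R_2\mu(\lambda)+(1+\overline\gamma)}$ (the characteristic function of $U_\gamma$); $\theta_\gamma$ also denotes its a.e. boundary values on $\mathbb T$, and $\Delta_\gamma=(1-|\theta_\gamma|^2)^{1/2}$ on $\mathbb T$. The (Sz.-Nagy–Foiaş) model space is $\mathcal K_{\theta}=\big(H^2\oplus\operatorname{clos}\Delta L^2\big)\ominus\{(\theta h,\Delta h):h\in H^2\}\subset L^2(\mathbb T;\mathbb C^2)$ (normalized Lebesgue measure), with $\theta=\theta_\gamma$, $\Delta=\Delta_\gamma$; the model operator is $\mathcal M_{\theta}=P_{\mathcal K_\theta}M_z|_{\mathcal K_\theta}$, $M_z$ being entrywise multiplication by $z$. For a contraction $T$, $\mathfrak D_T=\operatorname{clos}\operatorname{Ran}(I-T^*T)^{1/2}$ and $\mathfrak D_{T^*}=\operatorname{clos}\operatorname{Ran}(I-TT^*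 )^{1/2}$. *)

theory Defs
  imports "HOL-Probability.Probability"
begin

definition lebT :: "complex measure" where
  "lebT = distr (uniform_measure lborel {0..2*pi}) borel cis"

definition L2 :: "complex measure \<Rightarrow> (complex \<Rightarrow> complex) \<Rightarrow> bool" where
  "L2 M f \<longleftrightarrow> f \<in> borel_measurable M \<and> integrable M (\<lambda>x. (cmod (f x))\<^sup>2)"

definition ipL :: "complex measure \<Rightarrow> (complex \<Rightarrow> complex) \<Rightarrow> (complex \<Rightarrow> complex) \<Rightarrow> complex" where
  "ipL M f g = (LINT x|M. f x * cnj (g x))"

type_synonym v2 = "complex \<Rightarrow> complex \<times> complex"

definition ip2 :: "v2 \<Rightarrow> v2 \<Rightarrow> complex" where
  "ip2 x y = (LINT z|lebT. fst (x z) * cnj (fst (y z)) + snd (x z) * cnj (snd (y z)))"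

definition norm2 :: "v2 \<Rightarrow> real" where
  "norm2 x = sqrt (Re (ip2 x x))"

definition eq2 :: "v2 \<Rightarrow> v2 \<Rightarrow> bool" where
  "eq2 x y \<longleftrightarrow> (AE z in lebT. x z = y z)"

definition lc2 :: "complex \<Rightarrow> v2 \<Rightarrow> v2 \<Rightarrow> v2" where
  "lc2 a x y = (\<lambda>z. (a * fst (x z) + fst (y z), a * snd (x z) + snd (y z)))"

definition H2 :: "(complex \<Rightarrow> complex) \<Rightarrow> bool" where
  "H2 f \<longleftrightarrow> L2 lebT f \<and> (\<forall>n::nat. n \<ge> 1 \<longrightarrow> (LINT z|lebT. f z * z ^ n) = 0)"

definition closDeltaL2 :: "(complex \<Rightarrow> complex) \<Rightarrow> (complex \<Rightarrow> complex) \<Rightarrow> bool" where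
  "closDeltaL2 D g \<longleftrightarrow> L2 lebT g \<and>
     (\<forall>e>0. \<exists>h. L2 lebT h \<and> (LINT z|lebT. (cmod (g z - D z * h z))\<^sup>2) < e)"

definition bval :: "(complex \<Rightarrow> complex) \<Rightarrow> complex \<Rightarrow> complex" where
  "bval F z = (if \<exists>L. ((\<lambda>r. F (complex_of_real r * z)) \<longlongrightarrow> L) (at_left 1)
               then Lim (at_left 1) (\<lambda>r. F (complex_of_real r * z)) else 0)"

definition R2 :: "complex measure \<Rightarrow> complex \<Rightarrow> complex" where
  "R2 M w = (LINT \<xi>|M. (1 + cnj \<xi> * w) / (1 - cnj \<xi> * w))"

definition theta :: "complex measure \<Rightarrow> complex \<Rightarrow> complex \<Rightarrow> complex" where
  "theta M \<gamma> w = ((1 - \<gamma>) * R2 M w - (1 + \<gamma>)) / ((1 - cnj \<gamma>) * R2 M w + (1 + cnj \<gamma>))"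

definition thetaB :: "complex measure \<Rightarrow> complex \<Rightarrow> complex \<Rightarrow> complex" where
  "thetaB M \<gamma> = bval (theta M \<gamma>)"

definition DeltaB :: "complex measure \<Rightarrow> complex \<Rightarrow> complex \<Rightarrow> complex" where
  "DeltaB M \<gamma> z = complex_of_real (sqrt (1 - (cmod (thetaB M \<gamma> z))\<^sup>2))"

definition model_space :: "(complex \<Rightarrow> complex) \<Rightarrow> (complex \<Rightarrow> complex) \<Rightarrow> v2 set" where
  "model_space th D = {x. H2 (\<lambda>z. fst (x z)) \<and> closDeltaL2 D (\<lambda>z. snd (x z)) \<and>
      (\<forall>h. H2 h \<longrightarrow> ip2 x (\<lambda>z. (th z * h z, D z * h z)) = 0)}"

text \<open>orthogonal projection onto V (a representative of the class)\<close>
definition orth_proj :: "v2 set \<Rightarrow> v2 \<Rightarrow> v2" where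
  "orth_proj V y = (SOME x. x \<in> V \<and> (\<forall>k\<in>V. ip2 (lc2 (-1) x y) k = 0))"

definition model_op :: "v2 set \<Rightarrow> v2 \<Rightarrow> v2" where
  "model_op V x = orth_proj V (\<lambda>z. (z * fst (x z), z * snd (x z)))"

definition bdd_lin_op :: "v2 set \<Rightarrow> (v2 \<Rightarrow> v2) \<Rightarrow> bool" where
  "bdd_lin_op V S \<longleftrightarrow> (\<forall>x\<in>V. S x \<in> V) \<and>
     (\<forall>x\<in>V. \<forall>y\<in>V. \<forall>a. eq2 (S (lc2 a x y)) (lc2 a (S x) (S y))) \<and>
     (\<exists>C. \<forall>x\<in>V. norm2 (S x) \<le> C * norm2 x)"

definition is_adjoint :: "v2 set \<Rightarrow> (v2 \<Rightarrow> v2) \<Rightarrow> (v2 \<Rightarrow> v2) \<Rightarrow> bool" where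
  "is_adjoint V T T' \<longleftrightarrow> (\<forall>y\<in>V. T' y \<in> V) \<and> (\<forall>x\<in>V. \<forall>y\<in>V. ip2 (T x) y = ip2 x (T' y))"

definition is_pos_sqrt :: "v2 set \<Rightarrow> (v2 \<Rightarrow> v2) \<Rightarrow> (v2 \<Rightarrow> v2) \<Rightarrow> bool" where
  "is_pos_sqrt V A S \<longleftrightarrow> bdd_lin_op V S \<and>
     (\<forall>x\<in>V. Im (ip2 (S x) x) = 0 \<and> Re (ip2 (S x) x) \<ge> 0) \<and>
     (\<forall>x\<in>V. eq2 (S (S x)) (A x))"

definition in_clos_range :: "v2 set \<Rightarrow> (v2 \<Rightarrow> v2) \<Rightarrow> v2 \<Rightarrow> bool" where
  "in_clos_range V S c \<longleftrightarrow> c \<in> V \<and> (\<forall>e>0. \<exists>x\<in>V. norm2 (lc2 (-1) (S x) c) < e)"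

definition defect :: "v2 set \<Rightarrow> (v2 \<Rightarrow> v2) \<Rightarrow> v2 set" where
  "defect V T = {c. \<exists>T' S. is_adjoint V T T' \<and>
      is_pos_sqrt V (\<lambda>x. lc2 (-1) (T' (T x)) x) S \<and> in_clos_range V S c}"

definition defect_star :: "v2 set \<Rightarrow> (v2 \<Rightarrow> v2) \<Rightarrow> v2 set" where
  "defect_star V T = {c. \<exists>T' S. is_adjoint V T T' \<and>
      is_pos_sqrt V (\<lambda>x. lc2 (-1) (T (T' x)) x) S \<and> in_clos_range V S c}"

definition unitary_to :: "complex measure \<Rightarrow> v2 set \<Rightarrow> ((complex \<Rightarrow> complex) \<Rightarrow> v2) \<Rightarrow> bool" where
  "unitary_to M V \<Phi> \<longleftrightarrow>
     (\<forall>f. L2 M f \<longrightarrow> \<Phi> f \<in> V) \<and>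
     (\<forall>f g a. L2 M f \<longrightarrow> L2 M g \<longrightarrow> eq2 (\<Phi> (\<lambda>x. a * f x + g x)) (lc2 a (\<Phi> f) (\<Phi> g))) \<and>
     (\<forall>f g. L2 M f \<longrightarrow> L2 M g \<longrightarrow> ip2 (\<Phi> f) (\<Phi> g) = ipL M f g) \<and>
     (\<forall>k\<in>V. \<exists>f. L2 M f \<and> eq2 (\<Phi> f) k)"

text \<open>U_gamma f = xi f + (gamma - 1) (f, b1) b with b = 1, b1(xi) = conj xi\<close>
definition U\<gamma> :: "complex measure \<Rightarrow> complex \<Rightarrow> (complex \<Rightarrow> complex) \<Rightarrow> complex \<Rightarrow> complex" where
  "U\<gamma> M \<gamma> f = (\<lambda>\<xi>. \<xi> * f \<xi> + (\<gamma> - 1) * ipL M f (\<lambda>\<eta>. cnj \<eta>) * 1)"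

definition C1_T :: "(complex \<Rightarrow> complex) \<Rightarrow> bool" where
  "C1_T f \<longleftrightarrow> (\<exists>f'. continuous_on UNIV f' \<and>
      (\<forall>t. ((\<lambda>t. f (cis t)) has_vector_derivative f' t) (at t)))"

text \<open>a function on T viewed as a (Borel) function on C, zero off T\<close>
definition onT :: "(complex \<Rightarrow> complex) \<Rightarrow> complex \<Rightarrow> complex" where
  "onT f \<xi> = (if cmod \<xi> = 1 then f \<xi> else 0)"

end

theory Submission
  imports Defs "HOL-Library.Real_Mod"
begin

text \<open>On the orthogonal complement of \<open>b\<^sub>1\<close> the perturbation vanishes, so there \<open>U\<^sub>\<gamma>\<close> is
  multiplication by \<open>\<xi>\<close>, an isometry. Hence the compression \<open>P M\<^sub>z\<close> preserves the norm of
  \<open>\<Phi> f\<close>, which forces \<open>\<Phi> (\<xi>f) = z \<Phi> f\<close> for \<open>f \<bottom> b\<^sub>1\<close>. Splitting off the \<open>b\<^sub>1\<close> component yields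
  \<open>\<Phi> (\<xi>g) = z \<Phi> g + (\<integral> \<xi> g d\<mu>) (c - z c\<^sub>1)\<close> for all \<open>g\<close>. The right-hand side of the
  representation formula obeys the same recursion away from the countably many atoms of \<open>\<mu>\<close>,
  so the formula passes from \<open>1\<close> to all trigonometric polynomials. A \<open>C\<^sup>1\<close> function is
  approximated by trigonometric polynomials uniformly and in the Lipschitz seminorm; the first
  controls \<open>\<Phi>\<close> in \<open>L\<^sup>2\<close>, the second controls the singular integral.\<close>

section \<open>Trigonometric approximation of continuously differentiable functions\<close>

text \<open>On the circle \<open>cnj z\<close> is the inverse of z, so these are the Laurent
  polynomials there. Using \<open>cnj\<close> makes them defined on all of C and includes every real
  polynomial in Re z and Im z.\<close>

inductive trig_poly :: "(complex \<Rightarrow> complex) \<Rightarrow> bool" where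
  monomial: "trig_poly (\<lambda>z. a * z ^ m * cnj z ^ n)"
| add: "trig_poly p \<Longrightarrow> trig_poly q \<Longrightarrow> trig_poly (\<lambda>z. p z + q z)"

lemma trig_poly_const: "trig_poly (\<lambda>z. a)"
  using trig_poly.monomial[of a 0 0] by simp

lemma trig_poly_mult:
  assumes "trig_poly p" "trig_poly q"
  shows "trig_poly (\<lambda>z. p z * q z)"
  using assms(1)
proof induction
  case (monomial a m n)
  show ?case
    using assms(2)
  proof induction
    case (monomial b k l)
    show ?case
      using trig_poly.monomial[of "a * b" "m + k" "n + l"] by (simp add: power_add mult_ac)
  next
    case (add p q)
    then show ?case
      using trig_poly.add by (auto simp: distrib_left)
  qed
next
  case (add p q)
  then show ?case
    using trig_poly.add by (auto simp: distrib_right)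
qed

text \<open>Re z and Im z are combinations of z and \<open>cnj z\<close>. This brings the
  polynomials supplied by the Stone-Weierstrass theorem into trigonometric form.\<close>

lemma trig_poly_of_real_polynomial:
  "real_polynomial_function p \<Longrightarrow> trig_poly (\<lambda>z. complex_of_real (p z))"
proof (induction rule: real_polynomial_function.induct)
  case (linear f)
  interpret bounded_linear f by fact
  have f: "f z = Re z * f 1 + Im z * f \<i>" for z
  proof -
    have "f z = f (Re z *\<^sub>R 1 + Im z *\<^sub>R \<i>)"
      by (rule arg_cong[where f = f]) (simp add: complex_eq_iff)
    also have "\<dots> = Re z * f 1 + Im z * f \<i>"
      by (simp only: add scaleR real_scaleR_def)
    finally show ?thesis .
  qed
  \<comment> \<open>The coefficients come from Re z = (z + \<open>cnj z\<close>) / 2 and Im z = (z -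
    \<open>cnj z\<close>) / (2 \<open>\<i>\<close>).\<close>
  have "trig_poly (\<lambda>z. (of_real (f 1) / 2 - \<i> * of_real (f \<i>) / 2) * z ^ 1 * cnj z ^ 0
      + (of_real (f 1) / 2 + \<i> * of_real (f \<i>) / 2) * z ^ 0 * cnj z ^ 1)"
    by (intro trig_poly.intros)
  also have "(\<lambda>z. (of_real (f 1) / 2 - \<i> * of_real (f \<i>) / 2) * z ^ 1 * cnj z ^ 0
      + (of_real (f 1) / 2 + \<i> * of_real (f \<i>) / 2) * z ^ 0 * cnj z ^ 1)
      = (\<lambda>z. complex_of_real (f z))"
  proof
    fix z
    show "(of_real (f 1) / 2 - \<i> * of_real (f \<i>) / 2) * z ^ 1 * cnj z ^ 0
      + (of_real (f 1) / 2 + \<i> * of_real (f \<i>) / 2) * z ^ 0 * cnj z ^ 1 = complex_of_real (f z)"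
      unfolding f[of z] by (simp add: complex_eq_iff algebra_simps)
  qed
  finally show ?case .
next
  case (add f g)
  then show ?case
    using trig_poly.add by fastforce
next
  case (mult f g)
  then show ?case
    using trig_poly_mult by fastforce
qed (rule trig_poly_const)

lemma trig_poly_of_polynomial:
  fixes p :: "complex \<Rightarrow> complex"
  assumes "polynomial_function p"
  shows "trig_poly p"
proof -
  have "trig_poly (\<lambda>z. complex_of_real (Re (p z)) + \<i> * complex_of_real (Im (p z)))"
    using assms bounded_linear_Re bounded_linear_Im
    unfolding polynomial_function_def o_def
    by (intro trig_poly.add trig_poly_mult trig_poly_const trig_poly_of_real_polynomial) auto
  then show ?thesis
    by (simp flip: complex_eq)
qed

text \<open>A monomial restricts to a multiple of \<open>cis (d * t)\<close> with d = k - l. For d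
  \<noteq> 0 it integrates to a multiple of itself; the terms with d = 0 have no periodic primitive
  and add up to the mean \<open>m\<close>.\<close>

lemma trig_poly_antiderivative:
  assumes "trig_poly q"
  obtains m p where "trig_poly p"
    "\<And>t. ((\<lambda>t. p (cis t)) has_vector_derivative q (cis t) - m) (at t)"
proof -
  have "\<exists>m p. trig_poly p \<and> (\<forall>t. ((\<lambda>t. p (cis t)) has_vector_derivative q (cis t) - m) (at t))"
    using assms
  proof induction
    case (monomial a k l)
    have cisp: "cis t ^ k * cnj (cis t) ^ l = cis (real_of_int (int k - int l) * t)" for t
      by (simp add: cis_cnj Complex.DeMoivre cis_mult algebra_simps)
    show ?case
    proof (cases "k = l")
      case True
      then have "a * cis t ^ k * cnj (cis t) ^ l = a" for t
        unfolding mult.assoc cisp[of t] by simp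
      then show ?thesis
        by (intro exI[of _ a] exI[of _ "\<lambda>z. 0"] conjI trig_poly_const)
          (simp only: diff_self has_vector_derivative_const HOL.simp_thms)
    next
      case False
      define d where "d = real_of_int (int k - int l)"
      have "d \<noteq> 0"
        using False by (simp add: d_def)
      have "((\<lambda>t. a / (\<i> * d) * cis (d * t)) has_vector_derivative a * cis (d * t)) (at t)" for t
      proof -
        have "((\<lambda>w. a / (\<i> * d) * exp (\<i> * d * w)) has_field_derivative a * exp (\<i> * d * t)) (at (of_real t))"
          using \<open>d \<noteq> 0\<close> by (auto intro!: derivative_eq_intros)
        from has_vector_derivative_real_field[OF this] show ?thesis
          by (simp add: cis_conv_exp mult.assoc)
      qed
      then show ?thesis
        by (intro exI[of _ 0] exI[of _ "\<lambda>z. a / (\<i> * d) * z ^ k * cnj z ^ l"] conjI trig_poly.monomial)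
          (simp only: mult.assoc cisp d_def diff_0_right simp_thms)
    qed
  next
    case (add p q)
    then obtain m1 p1 m2 p2 where "trig_poly p1" "trig_poly p2"
      "\<forall>t. ((\<lambda>t. p1 (cis t)) has_vector_derivative p (cis t) - m1) (at t)"
      "\<forall>t. ((\<lambda>t. p2 (cis t)) has_vector_derivative q (cis t) - m2) (at t)"
      by blast
    then show ?case
      by (intro exI[of _ "m1 + m2"] exI[of _ "\<lambda>z. p1 z + p2 z"])
        (auto intro!: trig_poly.add has_vector_derivative_add simp: add_diff_add)
  qed
  then show ?thesis
    using that by blast
qed

text \<open>The angle is \<open>Arg (w / z)\<close>. For a short chord it is controlled by the
  logarithm near 1; a long chord is bounded below while the angle is at most pi.\<close>

lemma circle_chord:
  assumes "cmod z = 1" "cmod w = 1"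
  obtains a where "w = z * cis a" "\<bar>a\<bar> \<le> 2 * pi * cmod (w - z)"
proof
  define u where "u = w / z"
  have u: "cmod u = 1" "u \<noteq> 0" "z \<noteq> 0"
    using assms by (auto simp: u_def norm_divide)
  show "w = z * cis (Arg u)"
    using u by (simp add: cis_Arg_unique cis_Arg sgn_div_norm u_def)
  have "w - z = z * (u - 1)"
    using u by (simp add: u_def field_simps)
  then have eq: "cmod (w - z) = cmod (u - 1)"
    using assms by (simp add: norm_mult)
  show "\<bar>Arg u\<bar> \<le> 2 * pi * cmod (w - z)"
  proof (cases "cmod (u - 1) < 1 / 2")
    case True
    have "\<bar>Arg u\<bar> \<le> cmod (Ln u)"
      using u abs_Im_le_cmod[of "Ln u"] by (simp add: Arg_eq_Im_Ln)
    also have "\<dots> \<le> 2 * cmod (u - 1)"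
      using norm_Ln_le[OF True] by simp
    also have "\<dots> \<le> 2 * pi * cmod (u - 1)"
      using pi_gt3 by (intro mult_right_mono) auto
    finally show ?thesis
      by (simp add: eq)
  next
    case False
    \<comment> \<open>Here the chord is at least 1/2, so the factor 2 pi just covers the largest
      possible angle.\<close>
    have "\<bar>Arg u\<bar> \<le> pi"
      using Arg_bounded[of u] by auto
    also have "\<dots> \<le> 2 * pi * cmod (u - 1)"
      using False by simp
    finally show ?thesis
      by (simp add: eq)
  qed
qed

text \<open>The mean value inequality bounds the increment by e times the arc; comparing arc with
  chord costs the factor 2 pi.\<close>

lemma lipschitz_on_circle:
  assumes "\<And>t. ((\<lambda>t. g (cis t)) has_vector_derivative g' t) (at t)" "\<And>t. cmod (g' t) \<le> e"
  shows "(2 * pi * e)-lipschitz_on (sphere 0 1) g"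
proof (rule lipschitz_onI)
  have "0 \<le> e"
    using assms(2)[of 0] norm_ge_zero[of "g' 0"] by linarith
  then show "0 \<le> 2 * pi * e"
    by simp
  fix w z :: complex assume "w \<in> sphere 0 1" "z \<in> sphere 0 1"
  then have "cmod w = 1" "cmod z = 1" "z \<noteq> 0"
    by auto
  then obtain a where a: "w = z * cis a" "\<bar>a\<bar> \<le> 2 * pi * cmod (w - z)"
    using circle_chord by metis
  define t where "t = Arg z"
  have z: "z = cis t"
    using \<open>cmod z = 1\<close> \<open>z \<noteq> 0\<close> by (simp add: t_def cis_Arg sgn_div_norm)
  have "cmod (g (cis (t + a)) - g (cis t)) \<le> e * norm (t + a - t)"
    by (rule differentiable_bound[where S = UNIV and f = "\<lambda>t. g (cis t)" and f' = "\<lambda>t x. x *\<^sub>R g' t"])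
      (use assms in \<open>auto simp: has_vector_derivative_def onorm_scaleR_left[OF bounded_linear_ident] onorm_id\<close>)
  also have "\<dots> \<le> e * (2 * pi * cmod (w - z))"
    using a \<open>0 \<le> e\<close> by (intro mult_left_mono) auto
  finally show "dist (g w) (g z) \<le> 2 * pi * e * dist w z"
    by (simp add: a(1) z cis_mult dist_norm mult_ac add.commute)
qed

text \<open>At each z, \<open>Arg z + Im (Ln (w / z))\<close> is an angle of w that is continuous at
  w = z: the quotient is near 1, away from the branch cut. Centring the logarithm at z thus avoids
  the jump of \<open>Arg\<close>.\<close>

lemma continuous_on_circle_lift:
  fixes F :: "real \<Rightarrow> complex"
  assumes F: "continuous_on UNIV F" and GF: "\<And>t. G (cis t) = F t"
  shows "continuous_on (sphere 0 1) G"
  unfolding continuous_on_eq_continuous_within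
proof
  fix z :: complex assume "z \<in> sphere 0 1"
  then have "cmod z = 1" "z \<noteq> 0"
    by auto
  have z: "z = cis (Arg z)"
    using \<open>cmod z = 1\<close> \<open>z \<noteq> 0\<close> by (simp add: cis_Arg sgn_div_norm)
  have eq: "F (Arg z + Im (Ln (w / z))) = G w" if "w \<in> sphere 0 1" for w
  proof -
    have "w \<noteq> 0" "cmod w = 1"
      using that by auto
    have "cis (Arg z + Arg (w / z)) = cis (Arg z) * cis (Arg (w / z))"
      by (simp add: cis_mult)
    also have "\<dots> = z * (w / z)"
      using \<open>cmod z = 1\<close> \<open>z \<noteq> 0\<close> \<open>cmod w = 1\<close> \<open>w \<noteq> 0\<close>
      by (simp add: cis_Arg sgn_div_norm norm_divide)
    finally show ?thesis
      using \<open>z \<noteq> 0\<close> \<open>w \<noteq> 0\<close> by (simp add: Arg_eq_Im_Ln flip: GF)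
  qed
  have "isCont F t" for t
    using F by (simp add: continuous_on_eq_continuous_at)
  moreover have "continuous (at z within sphere 0 1) (\<lambda>w. Arg z + Im (Ln (w / z)))"
    using \<open>z \<noteq> 0\<close>
    by (intro continuous_intros bounded_linear.continuous[OF bounded_linear_Im]
        continuous_within_compose3[OF continuous_at_Ln]) auto
  ultimately have "continuous (at z within sphere 0 1) (\<lambda>w. F (Arg z + Im (Ln (w / z))))"
    by (rule continuous_within_compose3)
  then show "continuous (at z within sphere 0 1) G"
    by (rule continuous_transform_within[OF _ zero_less_one])
      (use \<open>z \<in> sphere 0 1\<close> in \<open>auto simp: eq\<close>)
qed

text \<open>The derivative is approximated uniformly and the approximant is integrated. The error
  then has a small derivative, hence a small Lipschitz constant, and an additive constant makes it
  uniformly small.\<close>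

lemma C1_T_trig_poly_approx:
  assumes "C1_T f" "0 < e"
  obtains p where "trig_poly p" "e-lipschitz_on (sphere 0 1) (\<lambda>z. f z - p z)"
    "\<And>z. cmod z = 1 \<Longrightarrow> cmod (f z - p z) \<le> e"
proof -
  \<comment> \<open>The derivative of the error will be at most 2 d, so its Lipschitz constant is at
    most 2 pi * 2 d = e / 2.\<close>
  define d where "d = e / (8 * pi)"
  have "0 < d"
    using assms(2) by (simp add: d_def)
  obtain F where F: "continuous_on UNIV F" "\<And>t. ((\<lambda>t. f (cis t)) has_vector_derivative F t) (at t)"
    using assms(1) by (auto simp: C1_T_def)
  define G where "G z = F (Arg z)" for z
  \<comment> \<open>Uniqueness of derivatives makes the derivative periodic, so it descends to a
    function \<open>G\<close> on the circle.\<close>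
  have "F (s + t) = F t" if "cis s = 1" for s t
  proof -
    have "((\<lambda>t. f (cis (s + t))) has_vector_derivative F (s + t)) (at t)"
      using vector_diff_chain_at[of "\<lambda>t. s + t" 1 t "\<lambda>t. f (cis t)" "F (s + t)"] F(2)[of "s + t"]
      by (simp add: o_def has_vector_derivative_add_const has_vector_derivative_id add.commute[of s])
    then have "((\<lambda>t. f (cis t)) has_vector_derivative F (s + t)) (at t)"
      using that by (simp flip: cis_mult)
    then show ?thesis
      using F(2) vector_derivative_unique_at by blast
  qed
  from this[of "Arg (cis t) - t" t for t] have GF: "G (cis t) = F t" for t
    by (simp add: G_def cis_Arg sgn_div_norm flip: cis_divide)
  have "continuous_on (sphere 0 1) G"
    using F(1) GF by (rule continuous_on_circle_lift)
  then obtain q where q: "polynomial_function q" "\<And>z. z \<in> sphere 0 1 \<Longrightarrow> norm (G z - q z) < d"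
    using Stone_Weierstrass_polynomial_function[OF compact_sphere _ \<open>0 < d\<close>] by metis
  obtain m p where p: "trig_poly p"
    "\<And>t. ((\<lambda>t. p (cis t)) has_vector_derivative q (cis t) - m) (at t)"
    using trig_poly_antiderivative trig_poly_of_polynomial q(1) by metis
  have Fq: "cmod (F t - q (cis t)) \<le> d" for t
    using q(2)[of "cis t"] by (simp add: GF)
  have der: "((\<lambda>t. f (cis t) - p (cis t)) has_vector_derivative F t - (q (cis t) - m)) (at t)" for t
    by (intro has_vector_derivative_diff F p)
  have "cmod m \<le> d"
  proof -
    \<comment> \<open>The linear term cancels the mean in the derivative, leaving
      \<open>F - q\<close>, which is at most d. Over a full period the periodic terms return to
      their values, so the increment of \<open>h\<close> is exactly -2 pi m.\<close>
    define h where "h t = f (cis t) - p (cis t) - t *\<^sub>R m" for t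
    have "(h has_vector_derivative F t - q (cis t)) (at t)" for t
      unfolding h_def by (rule derivative_eq_intros der refl)+ simp
    then have "norm (h (2 * pi) - h 0) \<le> d * norm (2 * pi - 0)"
      by (intro differentiable_bound[where S = UNIV and f = h and f' = "\<lambda>t x. x *\<^sub>R (F t - q (cis t))"])
        (use Fq in \<open>auto simp: has_vector_derivative_def onorm_scaleR_left[OF bounded_linear_ident] onorm_id\<close>)
    moreover have "h (2 * pi) - h 0 = - ((2 * pi) *\<^sub>R m)"
      by (simp add: h_def)
    ultimately have "2 * pi * cmod m \<le> 2 * pi * d"
      by (simp add: mult_ac)
    then show ?thesis
      by simp
  qed
  have "cmod (F t - (q (cis t) - m)) \<le> 2 * d" for t
    using norm_triangle_le[of "F t - q (cis t)" m "2 * d"] Fq[of t] \<open>cmod m \<le> d\<close>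
    by (simp add: algebra_simps)
  from lipschitz_on_circle[where g = "\<lambda>z. f z - p z", OF der this]
  have lip: "(e / 2)-lipschitz_on (sphere 0 1) (\<lambda>z. f z - p z)"
    by (simp add: d_def)
  \<comment> \<open>Now f and \<open>r\<close> agree at 1; as the circle has diameter 2, the
    Lipschitz constant e / 2 yields the uniform bound e.\<close>
  define r where "r z = p z + (f 1 - p 1)" for z
  have lipr: "(e / 2)-lipschitz_on (sphere 0 1) (\<lambda>z. f z - r z)"
    using lip by (simp add: lipschitz_on_def r_def dist_norm algebra_simps)
  show thesis
  proof
    show "trig_poly r"
      unfolding r_def by (intro trig_poly.add p trig_poly_const)
    show "e-lipschitz_on (sphere 0 1) (\<lambda>z. f z - r z)"
      using lipr assms(2) by (auto elim: lipschitz_on_le)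
    show "cmod (f z - r z) \<le> e" if "cmod z = 1" for z
    proof -
      have "dist (f z - r z) (f 1 - r 1) \<le> e / 2 * dist z 1"
        using lipr that by (intro lipschitz_onD) auto
      also have "\<dots> \<le> e / 2 * 2"
        using norm_triangle_ineq4[of z 1] that assms(2) by (intro mult_left_mono) (auto simp: dist_norm)
      finally show ?thesis
        by (simp add: r_def dist_norm)
    qed
  qed
qed

section \<open>Square-integrable functions on the circle\<close>

text \<open>Complex scalars acting on C^2: identities between values of model vectors are stated
  once instead of per component.\<close>

definition csmul :: "complex \<Rightarrow> complex \<times> complex \<Rightarrow> complex \<times> complex" where
  "csmul a x = (a * fst x, a * snd x)"

lemma csmul_simps:
  "csmul 1 x = x" "csmul 0 x = 0" "csmul (- a) x = - csmul a x"
  "csmul a (csmul b x) = csmul (a * b) x"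
  "csmul (a + b) x = csmul a x + csmul b x" "csmul a (x + y) = csmul a x + csmul a y"
  "csmul (a - b) x = csmul a x - csmul b x" "csmul a (x - y) = csmul a x - csmul a y"
  by (auto simp: csmul_def prod_eq_iff algebra_simps)

lemma csmul_cancel: "a \<noteq> 0 \<Longrightarrow> csmul a x = csmul a y \<longleftrightarrow> x = y"
  by (auto simp: csmul_def prod_eq_iff)

lemma norm_csmul: "norm (csmul a x) = cmod a * norm x"
proof -
  have "norm (csmul a x) = sqrt ((cmod a)\<^sup>2 * ((cmod (fst x))\<^sup>2 + (cmod (snd x))\<^sup>2))"
    by (simp add: csmul_def norm_prod_def norm_mult power_mult_distrib distrib_left)
  then show ?thesis
    by (simp add: norm_prod_def real_sqrt_mult)
qed

lemma lc2_eq_csmul: "lc2 a x y z = csmul a (x z) + y z"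
  by (simp add: lc2_def csmul_def prod_eq_iff)

lemma borel_measurable_cnj [measurable (raw)]:
  "f \<in> borel_measurable M \<Longrightarrow> (\<lambda>x. cnj (f x)) \<in> borel_measurable M"
  by (rule measurable_compose[of f M borel cnj borel])
    (auto intro!: borel_measurable_continuous_onI continuous_intros)

lemma L2_measurable: "L2 M f \<Longrightarrow> f \<in> borel_measurable M"
  by (simp add: L2_def)

lemma integrable_L2_mult_cnj:
  assumes "L2 M f" "L2 M g"
  shows "integrable M (\<lambda>x. f x * cnj (g x))"
proof (rule Bochner_Integration.integrable_bound)
  show "integrable M (\<lambda>x. (cmod (f x))\<^sup>2 + (cmod (g x))\<^sup>2)"
    using assms by (auto simp: L2_def)
  show "(\<lambda>x. f x * cnj (g x)) \<in> borel_measurable M"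
    using assms[THEN L2_measurable] by measurable
  have "a * b \<le> a\<^sup>2 + b\<^sup>2" for a b :: real
    using sum_squares_bound[of a b] sum_power2_ge_zero[of a b] by linarith
  then show "AE x in M. norm (f x * cnj (g x)) \<le> norm ((cmod (f x))\<^sup>2 + (cmod (g x))\<^sup>2)"
    by (simp add: norm_mult)
qed

lemma L2_lincomb:
  assumes "L2 M f" "L2 M g"
  shows "L2 M (\<lambda>x. a * f x + g x)"
  unfolding L2_def
proof
  show meas: "(\<lambda>x. a * f x + g x) \<in> borel_measurable M"
    using assms[THEN L2_measurable] by measurable
  show "integrable M (\<lambda>x. (cmod (a * f x + g x))\<^sup>2)"
  proof (rule Bochner_Integration.integrable_bound)
    show "integrable M (\<lambda>x. 2 * (cmod a)\<^sup>2 * (cmod (f x))\<^sup>2 + 2 * (cmod (g x))\<^sup>2)"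
      using assms by (auto simp: L2_def)
    show "(\<lambda>x. (cmod (a * f x + g x))\<^sup>2) \<in> borel_measurable M"
      using meas by measurable
    have "(cmod (a * f x + g x))\<^sup>2 \<le> 2 * (cmod a)\<^sup>2 * (cmod (f x))\<^sup>2 + 2 * (cmod (g x))\<^sup>2" for x
    proof -
      have "(cmod (a * f x + g x))\<^sup>2 \<le> (cmod (a * f x) + cmod (g x))\<^sup>2"
        by (intro power_mono norm_triangle_ineq) simp
      also have "\<dots> \<le> 2 * (cmod (a * f x))\<^sup>2 + 2 * (cmod (g x))\<^sup>2"
        using sum_squares_bound[of "cmod (a * f x)" "cmod (g x)"] by (simp add: power2_sum)
      finally show ?thesis
        by (simp add: norm_mult power_mult_distrib)
    qed
    then show "AE x in M. norm ((cmod (a * f x + g x))\<^sup>2)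
        \<le> norm (2 * (cmod a)\<^sup>2 * (cmod (f x))\<^sup>2 + 2 * (cmod (g x))\<^sup>2)"
      by simp
  qed
qed

lemma L2_unimodular_mult:
  assumes "L2 M f" "u \<in> borel_measurable M" "AE x in M. cmod (u x) = 1"
  shows "L2 M (\<lambda>x. u x * f x)"
  unfolding L2_def
proof
  note [measurable] = assms(2) L2_measurable[OF assms(1)]
  show "(\<lambda>x. u x * f x) \<in> borel_measurable M"
    by measurable
  have "integrable M (\<lambda>x. (cmod (f x))\<^sup>2)"
    using assms(1) by (simp add: L2_def)
  then show "integrable M (\<lambda>x. (cmod (u x * f x))\<^sup>2)"
    by (rule integrable_cong_AE_imp) (use assms(3) in \<open>auto simp: norm_mult\<close>)
qed

lemma L2_bounded:
  assumes "finite_measure M" "f \<in> borel_measurable M" "AE x in M. cmod (f x) \<le> C"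
  shows "L2 M f"
  unfolding L2_def
proof
  have "AE x in M. norm ((cmod (f x))\<^sup>2) \<le> C\<^sup>2"
    using assms(3) by eventually_elim (auto intro: power_mono)
  then show "integrable M (\<lambda>x. (cmod (f x))\<^sup>2)"
    by (rule finite_measure.integrable_const_bound[OF assms(1)]) (use assms(2) in measurable)
qed fact

section \<open>Null sets of normalized Lebesgue measure on the circle\<close>

lemma sets_lebT [simp, measurable_cong]: "sets lebT = sets borel"
  by (simp add: lebT_def)

lemma space_lebT [simp]: "space lebT = UNIV"
  by (simp add: lebT_def)

lemma cis_borel [measurable]: "cis \<in> borel_measurable borel"
  by (intro borel_measurable_continuous_onI continuous_intros)

lemma AE_lebTI:
  assumes "{z. P z} \<in> sets borel" "AE t in lborel. P (cis t)"
  shows "AE z in lebT. P z"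
proof -
  have "AE t in uniform_measure lborel {0..2 * pi}. P (cis t)"
    using assms(2) by (intro AE_uniform_measureI) auto
  moreover have "cis \<in> measurable (uniform_measure lborel {0..2 * pi}) borel"
    by simp
  ultimately show ?thesis
    unfolding lebT_def using assms(1) by (subst AE_distr_iff) auto
qed

lemma AE_lebT_circle: "AE z in lebT. cmod z = 1"
  by (rule AE_lebTI) auto

text \<open>The preimage of a point under \<open>cis\<close> lies in a countable set of angles. This
  later discards the atoms of \<mu>.\<close>

lemma AE_lebT_neq: "AE w in lebT. w \<noteq> z"
proof -
  have "{t. cis t = z} \<subseteq> (\<Union>n::int. {Arg z + of_int n * (2 * pi)})"
  proof
    fix t assume "t \<in> {t. cis t = z}"
    then have z: "cis t = z"
      by simp
    then have "cmod z = 1" "z \<noteq> 0"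
      by auto
    then have "cis (Arg z) = z"
      by (simp add: cis_Arg sgn_div_norm)
    with z \<open>z \<noteq> 0\<close> have "cis (t - Arg z) = 1"
      by (simp flip: cis_divide)
    then show "t \<in> (\<Union>n::int. {Arg z + of_int n * (2 * pi)})"
      by (auto simp: cis_eq_1_iff algebra_simps)
  qed
  then have "countable {t. cis t = z}"
    by (rule countable_subset) auto
  then have "AE t in lborel. cis t \<noteq> z"
    using AE_not_in[OF countable_imp_null_set_lborel, of "{t. cis t = z}"] by auto
  then show ?thesis
    by (intro AE_lebTI) auto
qed

section \<open>The ambient space L^2(T; C^2) of the model\<close>

definition L2_pair :: "v2 \<Rightarrow> bool" where
  "L2_pair x \<longleftrightarrow> L2 lebT (\<lambda>z. fst (x z)) \<and> L2 lebT (\<lambda>z. snd (x z))"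

definition mult_z :: "v2 \<Rightarrow> v2" where
  "mult_z x = (\<lambda>z. (z * fst (x z), z * snd (x z)))"

lemma mult_z_eq_csmul: "mult_z x z = csmul z (x z)"
  by (simp add: mult_z_def csmul_def)

lemma L2_pair_lc2: "L2_pair x \<Longrightarrow> L2_pair y \<Longrightarrow> L2_pair (lc2 a x y)"
  by (simp add: L2_pair_def lc2_def L2_lincomb)

lemma L2_pair_mult_z: "L2_pair x \<Longrightarrow> L2_pair (mult_z x)"
  unfolding L2_pair_def mult_z_def fst_conv snd_conv
  by (intro conjI L2_unimodular_mult AE_lebT_circle) auto

lemma ip2_integrable:
  assumes "L2_pair x" "L2_pair y"
  shows "integrable lebT (\<lambda>z. fst (x z) * cnj (fst (y z)) + snd (x z) * cnj (snd (y z)))"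
  using assms by (intro Bochner_Integration.integrable_add integrable_L2_mult_cnj) (auto simp: L2_pair_def)

lemma ip2_lc2_left:
  assumes "L2_pair x" "L2_pair y" "L2_pair k"
  shows "ip2 (lc2 a x y) k = a * ip2 x k + ip2 y k"
proof -
  have "ip2 (lc2 a x y) k = (LINT z|lebT. a * (fst (x z) * cnj (fst (k z)) + snd (x z) * cnj (snd (k z)))
      + (fst (y z) * cnj (fst (k z)) + snd (y z) * cnj (snd (k z))))"
    by (simp add: ip2_def lc2_def algebra_simps)
  also have "\<dots> = a * ip2 x k + ip2 y k"
    using ip2_integrable[OF assms(1,3)] ip2_integrable[OF assms(2,3)] by (simp add: ip2_def)
  finally show ?thesis .
qed

lemma ip2_commute: "ip2 y x = cnj (ip2 x y)"
  unfolding ip2_def Bochner_Integration.integral_cnj[symmetric] by (simp add: mult.commute)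

lemma ip2_cong:
  assumes "L2_pair x" "L2_pair y" "L2_pair x'" "L2_pair y'" "eq2 x x'" "eq2 y y'"
  shows "ip2 x y = ip2 x' y'"
  unfolding ip2_def
proof (rule integral_cong_AE)
  show "AE z in lebT. fst (x z) * cnj (fst (y z)) + snd (x z) * cnj (snd (y z)) =
      fst (x' z) * cnj (fst (y' z)) + snd (x' z) * cnj (snd (y' z))"
    using assms(5,6) unfolding eq2_def by eventually_elim simp
qed (intro borel_measurable_integrable ip2_integrable assms)+

lemma ip2_mult_z:
  assumes "L2_pair x" "L2_pair y"
  shows "ip2 (mult_z x) (mult_z y) = ip2 x y"
  unfolding ip2_def
proof (rule integral_cong_AE)
  show "AE z in lebT. fst (mult_z x z) * cnj (fst (mult_z y z)) + snd (mult_z x z) * cnj (snd (mult_z y z)) =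
      fst (x z) * cnj (fst (y z)) + snd (x z) * cnj (snd (y z))"
    using AE_lebT_circle
  proof eventually_elim
    case (elim z)
    then have "z * cnj z = 1"
      by (simp add: complex_norm_square[symmetric])
    moreover have "fst (mult_z x z) * cnj (fst (mult_z y z)) + snd (mult_z x z) * cnj (snd (mult_z y z)) =
      (z * cnj z) * (fst (x z) * cnj (fst (y z)) + snd (x z) * cnj (snd (y z)))"
      by (simp add: mult_z_def algebra_simps)
    ultimately show ?case
      by simp
  qed
qed (intro borel_measurable_integrable ip2_integrable L2_pair_mult_z assms)+

lemma ip2_self: "ip2 x x = of_real (LINT z|lebT. (norm (x z))\<^sup>2)"
  unfolding ip2_def integral_complex_of_real[symmetric]
  by (simp add: norm_prod_def complex_norm_square[symmetric])

lemma L2_pair_norm_integrable: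
  assumes "L2_pair x"
  shows "integrable lebT (\<lambda>z. (norm (x z))\<^sup>2)"
  using assms by (simp add: L2_pair_def L2_def norm_prod_def)

lemma ip2_self_eq_0:
  assumes "L2_pair x" "ip2 x x = 0"
  shows "AE z in lebT. x z = 0"
  using assms(2) integral_nonneg_eq_0_iff_AE[OF L2_pair_norm_integrable[OF assms(1)]]
  by (simp add: ip2_self)

section \<open>Operators intertwining a shift with the model operator\<close>

text \<open>\<open>V\<close> stands for the model space. Intertwining is stated on the complement of
  b1 = \<open>cnj\<close>, where U_gamma is multiplication by \<xi>.\<close>

locale model_intertwiner =
  fixes \<mu> :: "complex measure" and V :: "v2 set"
    and \<Phi> :: "(complex \<Rightarrow> complex) \<Rightarrow> v2" and c c1 :: v2
  assumes prob: "prob_space \<mu>"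
    and sets_mu [simp, measurable_cong]: "sets \<mu> = sets borel"
    and circle: "emeasure \<mu> (sphere 0 1) = 1"
    and V_L2: "x \<in> V \<Longrightarrow> L2_pair x"
    and unitary: "unitary_to \<mu> V \<Phi>"
    and intertwining: "L2 \<mu> f \<Longrightarrow> ipL \<mu> f cnj = 0 \<Longrightarrow>
      eq2 (\<Phi> (\<lambda>\<xi>. \<xi> * f \<xi>)) (model_op V (\<Phi> f))"
    and Phi_one: "eq2 (\<Phi> (\<lambda>\<xi>. 1)) c"
    and Phi_cnj: "eq2 (\<Phi> cnj) c1"
begin

interpretation prob_space \<mu>
  by (rule prob)

lemma space_mu [simp]: "space \<mu> = UNIV"
  using sets_eq_imp_space_eq[OF sets_mu] by simp

lemma borel_measurable_mu: "borel_measurable \<mu> = borel_measurable borel"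
  by (rule measurable_cong_sets) simp_all

lemma AE_mu_circle: "AE \<xi> in \<mu>. cmod \<xi> = 1"
proof -
  have "prob (sphere 0 1) = 1"
    using circle by (simp add: measure_def)
  then have "AE \<xi> in \<mu>. \<xi> \<in> sphere 0 1"
    by (subst (asm) prob_eq_1) auto
  then show ?thesis
    by simp
qed

section \<open>The isometry \<Phi> and its relation to the shift\<close>

lemma L2_id_mult: "L2 \<mu> f \<Longrightarrow> L2 \<mu> (\<lambda>\<xi>. \<xi> * f \<xi>)"
  by (rule L2_unimodular_mult) (simp_all add: AE_mu_circle borel_measurable_mu)

lemma L2_one: "L2 \<mu> (\<lambda>\<xi>. 1)"
  by (rule L2_bounded[OF finite_measure_axioms, where C = 1]) auto

lemma L2_cnj: "L2 \<mu> cnj"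
proof (rule L2_bounded[OF finite_measure_axioms])
  show "AE \<xi> in \<mu>. cmod (cnj \<xi>) \<le> 1"
    using AE_mu_circle by eventually_elim simp
qed (simp add: borel_measurable_mu)

lemma Phi_in: "L2 \<mu> f \<Longrightarrow> \<Phi> f \<in> V"
  using unitary by (simp add: unitary_to_def)

lemma Phi_L2: "L2 \<mu> f \<Longrightarrow> L2_pair (\<Phi> f)"
  by (intro V_L2 Phi_in)

lemma Phi_lincomb:
  "L2 \<mu> f \<Longrightarrow> L2 \<mu> g \<Longrightarrow> AE z in lebT. \<Phi> (\<lambda>\<xi>. a * f \<xi> + g \<xi>) z = csmul a (\<Phi> f z) + \<Phi> g z"
  using unitary by (simp add: unitary_to_def eq2_def lc2_eq_csmul)

lemma Phi_isometry: "L2 \<mu> f \<Longrightarrow> L2 \<mu> g \<Longrightarrow> ip2 (\<Phi> f) (\<Phi> g) = ipL \<mu> f g"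
  using unitary by (simp add: unitary_to_def)

lemma ipL_self: "ipL \<mu> f f = of_real (LINT \<xi>|\<mu>. (cmod (f \<xi>))\<^sup>2)"
  unfolding ipL_def integral_complex_of_real[symmetric] by (simp add: complex_norm_square[symmetric])

lemma ipL_id_mult: "ipL \<mu> (\<lambda>\<xi>. \<xi> * f \<xi>) (\<lambda>\<xi>. \<xi> * f \<xi>) = ipL \<mu> f f" if "L2 \<mu> f"
proof -
  note [measurable] = that[THEN L2_measurable] L2_id_mult[OF that, THEN L2_measurable]
  have "(LINT \<xi>|\<mu>. (cmod (\<xi> * f \<xi>))\<^sup>2) = (LINT \<xi>|\<mu>. (cmod (f \<xi>))\<^sup>2)"
    by (rule integral_cong_AE) (use AE_mu_circle in \<open>auto simp: norm_mult\<close>)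
  then show ?thesis
    by (simp add: ipL_self)
qed

text \<open>\<Phi> takes functions, not classes. It respects \<mu>-a.e. equality because it is
  linear and isometric: the difference has norm zero, and so does its image.\<close>

lemma Phi_cong_AE:
  assumes "L2 \<mu> f" "L2 \<mu> g" "AE \<xi> in \<mu>. f \<xi> = g \<xi>"
  shows "AE z in lebT. \<Phi> f z = \<Phi> g z"
proof -
  define h where "h = (\<lambda>\<xi>. (-1) * f \<xi> + g \<xi>)"
  have h: "L2 \<mu> h"
    unfolding h_def by (intro L2_lincomb assms)
  note [measurable] = L2_measurable[OF h]
  have "AE \<xi> in \<mu>. h \<xi> = 0"
    using assms(3) by eventually_elim (simp add: h_def)
  then have "ipL \<mu> h h = of_real (LINT \<xi>|\<mu>. 0)"
    unfolding ipL_self by (intro arg_cong[OF integral_cong_AE]) auto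
  then have "AE z in lebT. \<Phi> h z = 0"
    by (intro ip2_self_eq_0 Phi_L2 h) (simp add: Phi_isometry h)
  with Phi_lincomb[OF assms(1,2), of "-1"] show ?thesis
    unfolding h_def by eventually_elim (simp add: csmul_simps)
qed

text \<open>\<open>\<Phi> (\<xi>f)\<close> is the projection of \<open>z \<Phi> f\<close> and has the same norm, so the two coincide.\<close>

lemma Phi_shift_if_projection:
  assumes f: "L2 \<mu> f" "ipL \<mu> f cnj = 0"
    and ex: "\<exists>x. x \<in> V \<and> (\<forall>k\<in>V. ip2 (lc2 (-1) x (mult_z (\<Phi> f))) k = 0)"
  shows "AE z in lebT. \<Phi> (\<lambda>\<xi>. \<xi> * f \<xi>) z = csmul z (\<Phi> f z)"
proof -
  define p where "p = model_op V (\<Phi> f)"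
  define y where "y = mult_z (\<Phi> f)"
  define d where "d = lc2 (-1) p y"
  have "p = (SOME x. x \<in> V \<and> (\<forall>k\<in>V. ip2 (lc2 (-1) x y) k = 0))"
    by (simp add: p_def y_def model_op_def orth_proj_def mult_z_def)
  with someI_ex[OF ex] have p: "p \<in> V" "ip2 d p = 0"
    by (auto simp: y_def d_def)
  have L2: "L2_pair p" "L2_pair y" "L2_pair d" "L2_pair (\<Phi> (\<lambda>\<xi>. \<xi> * f \<xi>))"
    using p(1) f(1) by (auto simp: y_def d_def V_L2 Phi_L2 L2_id_mult intro!: L2_pair_mult_z L2_pair_lc2)
  have eq: "eq2 (\<Phi> (\<lambda>\<xi>. \<xi> * f \<xi>)) p"
    unfolding p_def by (intro intertwining f)
  have "ip2 p p = ip2 (\<Phi> (\<lambda>\<xi>. \<xi> * f \<xi>)) (\<Phi> (\<lambda>\<xi>. \<xi> * f \<xi>))"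
    by (intro ip2_cong[symmetric] L2 eq)
  also have "\<dots> = ip2 y y"
    using f(1) by (simp add: y_def ip2_mult_z Phi_L2 Phi_isometry L2_id_mult ipL_id_mult)
  finally have pp: "ip2 p p = ip2 y y" .
  \<comment> \<open>Pythagoras: \<open>d\<close> = y - p is orthogonal to \<open>p\<close>, and
    \<open>p\<close> and \<open>y\<close> have equal norms, so \<open>d\<close> has norm
    zero.\<close>
  have "ip2 y p = ip2 p p"
    using p(2) L2 by (simp add: d_def ip2_lc2_left)
  moreover from this have "ip2 p y = ip2 p p"
    by (metis ip2_commute)
  moreover have "ip2 p d = 0"
    by (subst ip2_commute) (simp add: p)
  moreover have "ip2 d y = ip2 y y - ip2 p y"
    using L2 by (simp add: d_def ip2_lc2_left)
  ultimately have "ip2 y d = 0"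
    using pp by (subst ip2_commute) simp
  then have "ip2 d d = 0"
    using L2 \<open>ip2 p d = 0\<close> unfolding d_def by (subst ip2_lc2_left) auto
  with L2(3) have "AE z in lebT. d z = 0"
    by (rule ip2_self_eq_0)
  with eq show ?thesis
    unfolding eq2_def by eventually_elim (simp add: d_def y_def lc2_eq_csmul csmul_simps mult_z_eq_csmul)
qed

text \<open>The projection \<^const>\<open>orth_proj\<close> is a choice that is arbitrary where no projection
  exists. If this happened for both \<open>f\<close> and \<open>2f\<close>, the two choices would agree, which forces
  \<open>\<Phi> (\<xi>f) = 0\<close> and hence \<open>f = 0\<close>; completeness of \<open>V\<close> is therefore not needed.\<close>

lemma Phi_shift_perp:
  assumes f: "L2 \<mu> f" "ipL \<mu> f cnj = 0"
  shows "AE z in lebT. \<Phi> (\<lambda>\<xi>. \<xi> * f \<xi>) z = csmul z (\<Phi> f z)"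
proof -
  define P where "P x y \<longleftrightarrow> x \<in> V \<and> (\<forall>k\<in>V. ip2 (lc2 (-1) x (mult_z y)) k = 0)" for x y
  have model_op: "model_op V y = (SOME x. P x y)" for y
    by (simp add: P_def model_op_def orth_proj_def mult_z_def)
  \<comment> \<open>This is 2 f, written in the shape a f + g in which linearity of \<Phi> is
    stated.\<close>
  define f2 where "f2 = (\<lambda>\<xi>. 1 * f \<xi> + f \<xi>)"
  have f2: "L2 \<mu> f2"
    unfolding f2_def by (intro L2_lincomb f)
  have "ipL \<mu> f2 cnj = 2 * ipL \<mu> f cnj"
    unfolding ipL_def integral_mult_right_zero[symmetric] by (simp add: f2_def algebra_simps)
  then have perp2: "ipL \<mu> f2 cnj = 0"
    by (simp add: f)
  have "(\<lambda>\<xi>. \<xi> * f2 \<xi>) = (\<lambda>\<xi>. 1 * (\<xi> * f \<xi>) + \<xi> * f \<xi>)"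
    by (simp add: f2_def algebra_simps)
  then have shift2: "AE z in lebT. \<Phi> (\<lambda>\<xi>. \<xi> * f2 \<xi>) z = csmul 2 (\<Phi> (\<lambda>\<xi>. \<xi> * f \<xi>) z)"
    using Phi_lincomb[OF L2_id_mult L2_id_mult, OF f(1) f(1), of 1]
    by (simp add: csmul_simps flip: csmul_simps(5)[of 1 1, simplified])
  have Phi2: "AE z in lebT. \<Phi> f2 z = csmul 2 (\<Phi> f z)"
    using Phi_lincomb[OF f(1) f(1), of 1]
    by (simp add: f2_def csmul_simps flip: csmul_simps(5)[of 1 1, simplified])
  consider "\<exists>x. P x (\<Phi> f)" | "\<exists>x. P x (\<Phi> f2)" | "\<nexists>x. P x (\<Phi> f)" "\<nexists>x. P x (\<Phi> f2)"
    by blast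
  then show ?thesis
  proof cases
    case 1
    then show ?thesis
      unfolding P_def by (intro Phi_shift_if_projection f)
  next
    case 2
    then have "AE z in lebT. \<Phi> (\<lambda>\<xi>. \<xi> * f2 \<xi>) z = csmul z (\<Phi> f2 z)"
      unfolding P_def by (intro Phi_shift_if_projection f2 perp2)
    with shift2 Phi2 show ?thesis
    proof eventually_elim
      case (elim z)
      then have "csmul 2 (\<Phi> (\<lambda>\<xi>. \<xi> * f \<xi>) z) = csmul 2 (csmul z (\<Phi> f z))"
        by (simp add: csmul_simps mult.commute)
      then show ?case
        by (simp add: csmul_cancel)
    qed
  next
    case 3
    then have eq: "model_op V (\<Phi> f) = model_op V (\<Phi> f2)"
      by (simp add: model_op)
    from intertwining[OF f] intertwining[OF f2 perp2]
    have "AE z in lebT. \<Phi> (\<lambda>\<xi>. \<xi> * f \<xi>) z = \<Phi> (\<lambda>\<xi>. \<xi> * f2 \<xi>) z"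
      unfolding eq2_def eq by eventually_elim simp
    with shift2 have zero: "AE z in lebT. \<Phi> (\<lambda>\<xi>. \<xi> * f \<xi>) z = 0"
      by eventually_elim (simp add: csmul_def prod_eq_iff)
    have L2: "L2_pair (\<Phi> (\<lambda>\<xi>. \<xi> * f \<xi>))"
      by (intro Phi_L2 L2_id_mult f)
    have "(LINT z|lebT. (norm (\<Phi> (\<lambda>\<xi>. \<xi> * f \<xi>) z))\<^sup>2) = (LINT z|lebT. 0)"
      by (rule integral_cong_AE)
        (use zero L2[THEN L2_pair_norm_integrable, THEN borel_measurable_integrable] in auto)
    \<comment> \<open>\<Phi> and multiplication by \<xi> both preserve norms, so the vanishing of
      the image of \<xi> f passes to that of f.\<close>
    then have "ip2 (\<Phi> f) (\<Phi> f) = 0"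
      using f(1) by (simp add: Phi_isometry flip: ipL_id_mult)
        (simp add: L2_id_mult ip2_self flip: Phi_isometry)
    with f(1) have "AE z in lebT. \<Phi> f z = 0"
      by (intro ip2_self_eq_0 Phi_L2)
    with zero show ?thesis
      by eventually_elim (simp add: csmul_def prod_eq_iff)
  qed
qed

text \<open>The coefficient B_gamma. Since \<xi> b1 = 1 on the circle, it is the failure of \<Phi>
  to turn \<xi> into z on the vector b1.\<close>

definition B :: v2 where
  "B z = c z - csmul z (c1 z)"

lemma Phi_shift:
  assumes g: "L2 \<mu> g"
  shows "AE z in lebT. \<Phi> (\<lambda>\<xi>. \<xi> * g \<xi>) z = csmul z (\<Phi> g z) + csmul (LINT \<xi>|\<mu>. \<xi> * g \<xi>) (B z)"
proof -
  \<comment> \<open>This is the inner product (g, b1). As b1 is a unit vector, subtracting s b1 from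
    g leaves \<open>f\<close> orthogonal to b1.\<close>
  define s where "s = (LINT \<xi>|\<mu>. \<xi> * g \<xi>)"
  define f where "f = (\<lambda>\<xi>. - s * cnj \<xi> + g \<xi>)"
  have f: "L2 \<mu> f"
    unfolding f_def by (intro L2_lincomb L2_cnj g)
  have "ipL \<mu> cnj cnj = of_real (LINT \<xi>|\<mu>. 1)"
    unfolding ipL_self
    by (rule arg_cong[OF integral_cong_AE]) (use AE_mu_circle in \<open>auto simp: borel_measurable_mu\<close>)
  then have cnj: "(LINT \<xi>|\<mu>. cnj \<xi> * cnj (cnj \<xi>)) = 1"
    using prob_space by (simp add: ipL_def)
  have "ipL \<mu> f cnj = (LINT \<xi>|\<mu>. - s * (cnj \<xi> * cnj (cnj \<xi>)) + g \<xi> * cnj (cnj \<xi>))"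
    by (simp add: ipL_def f_def algebra_simps)
  also have "\<dots> = - s * (LINT \<xi>|\<mu>. cnj \<xi> * cnj (cnj \<xi>)) + (LINT \<xi>|\<mu>. g \<xi> * cnj (cnj \<xi>))"
    using integrable_L2_mult_cnj[OF L2_cnj L2_cnj] integrable_L2_mult_cnj[OF g L2_cnj]
    by (subst Bochner_Integration.integral_add) auto
  also have "\<dots> = 0"
    by (simp only: cnj) (simp add: s_def mult.commute)
  finally have perp: "ipL \<mu> f cnj = 0" .
  \<comment> \<open>Multiplying g = s b1 + f by \<xi> turns b1 into 1, but only on the circle, hence
    the a.e. argument.\<close>
  have "AE z in lebT. \<Phi> (\<lambda>\<xi>. \<xi> * g \<xi>) z = \<Phi> (\<lambda>\<xi>. s * 1 + \<xi> * f \<xi>) z"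
  proof (rule Phi_cong_AE)
    show "AE \<xi> in \<mu>. \<xi> * g \<xi> = s * 1 + \<xi> * f \<xi>"
      using AE_mu_circle
    proof eventually_elim
      case (elim \<xi>)
      then have "\<xi> * cnj \<xi> = 1"
        by (simp add: complex_norm_square[symmetric])
      moreover have "s * 1 + \<xi> * f \<xi> = s * (1 - \<xi> * cnj \<xi>) + \<xi> * g \<xi>"
        by (simp add: f_def algebra_simps)
      ultimately show ?case
        by simp
    qed
  qed (intro L2_lincomb L2_one L2_id_mult f g)+
  moreover have "AE z in lebT. \<Phi> (\<lambda>\<xi>. s * 1 + \<xi> * f \<xi>) z
      = csmul s (\<Phi> (\<lambda>\<xi>. 1) z) + \<Phi> (\<lambda>\<xi>. \<xi> * f \<xi>) z"
    by (intro Phi_lincomb L2_one L2_id_mult f)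
  moreover have "AE z in lebT. \<Phi> f z = csmul (- s) (\<Phi> cnj z) + \<Phi> g z"
    unfolding f_def by (intro Phi_lincomb L2_cnj g)
  ultimately show ?thesis
    using Phi_shift_perp[OF f perp] Phi_one Phi_cnj unfolding eq2_def s_def[symmetric]
    by eventually_elim (simp add: B_def csmul_simps mult.commute)
qed

text \<open>For z on the circle the quotient at \<xi> = z is 0 / 0 = 0, so an atom of \<mu> at z
  contributes nothing.\<close>

definition J :: "(complex \<Rightarrow> complex) \<Rightarrow> complex \<Rightarrow> complex" where
  "J f z = (LINT \<xi>|\<mu>. (onT f \<xi> - f z) / (1 - cnj \<xi> * z))"

definition represented :: "(complex \<Rightarrow> complex) \<Rightarrow> bool" where
  "represented f \<longleftrightarrow> (AE z in lebT. \<Phi> (onT f) z = csmul (f z) (c z) + csmul (J f z) (B z))"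

text \<open>Multiply by the unimodular \<xi>. In modulus the integrand of \<open>J\<close> is
  therefore a difference quotient, which a Lipschitz constant bounds.\<close>

lemma norm_one_minus_cnj_mult:
  assumes "cmod \<xi> = 1"
  shows "cmod (1 - cnj \<xi> * z) = cmod (\<xi> - z)"
proof -
  have "\<xi> * cnj \<xi> = 1"
    using assms by (simp add: complex_norm_square[symmetric])
  then have "\<xi> - z = \<xi> * (1 - cnj \<xi> * z)"
    by (simp add: right_diff_distrib flip: mult.assoc)
  then show ?thesis
    using assms by (simp add: norm_mult)
qed

section \<open>The singular integral of Lipschitz functions and its recursion\<close>

context
  fixes L and f :: "complex \<Rightarrow> complex"
  assumes lip: "L-lipschitz_on (sphere 0 1) f"
begin

lemma onT_borel [measurable]: "onT f \<in> borel_measurable borel"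
proof -
  have "(\<lambda>\<xi>. if \<xi> \<in> sphere 0 1 then f \<xi> else 0) \<in> borel_measurable borel"
    by (intro borel_measurable_continuous_on_if lipschitz_on_continuous_on[OF lip] continuous_intros) auto
  then show ?thesis
    by (simp add: onT_def[abs_def])
qed

lemma quotient_bound:
  assumes "cmod z = 1"
  shows "AE \<xi> in \<mu>. cmod ((onT f \<xi> - f z) / (1 - cnj \<xi> * z)) \<le> L"
  using AE_mu_circle
proof eventually_elim
  case (elim \<xi>)
  have "cmod (f \<xi> - f z) \<le> L * cmod (\<xi> - z)"
    using lipschitz_onD[OF lip, of \<xi> z] elim assms by (simp add: dist_norm)
  \<comment> \<open>For \<xi> = z the quotient is zero by the division convention, and L is
    nonnegative.\<close>
  then show ?case
    using elim lipschitz_on_nonneg[OF lip]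
    by (cases "\<xi> = z") (simp_all add: norm_divide norm_one_minus_cnj_mult onT_def divide_le_eq)
qed

lemma quotient_integrable:
  assumes "cmod z = 1"
  shows "integrable \<mu> (\<lambda>\<xi>. (onT f \<xi> - f z) / (1 - cnj \<xi> * z))"
  by (rule integrable_const_bound[OF quotient_bound[OF assms]]) (simp add: borel_measurable_mu, measurable)

lemma norm_J_le:
  assumes "cmod z = 1"
  shows "cmod (J f z) \<le> L"
proof -
  have "cmod (J f z) \<le> (LINT \<xi>|\<mu>. cmod ((onT f \<xi> - f z) / (1 - cnj \<xi> * z)))"
    unfolding J_def by (rule integral_norm_bound)
  also have "\<dots> \<le> (LINT \<xi>|\<mu>. L)"
    by (intro integral_mono_AE integrable_norm quotient_integrable quotient_bound assms) simp
  finally show ?thesis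
    using prob_space by simp
qed

lemma lipschitz_circle_bound:
  assumes "cmod z = 1"
  shows "cmod (f z) \<le> cmod (f 1) + 2 * L"
proof -
  have "cmod (f z - f 1) \<le> L * cmod (z - 1)"
    using lipschitz_onD[OF lip, of z 1] assms by (simp add: dist_norm)
  also have "\<dots> \<le> L * 2"
    using norm_triangle_ineq4[of z 1] assms lipschitz_on_nonneg[OF lip] by (intro mult_left_mono) auto
  finally show ?thesis
    using norm_triangle_ineq2[of "f z" "f 1"] by simp
qed

lemma L2_onT: "L2 \<mu> (onT f)"
proof (rule L2_bounded[OF finite_measure_axioms])
  show "AE \<xi> in \<mu>. cmod (onT f \<xi>) \<le> cmod (f 1) + 2 * L"
    using AE_mu_circle by eventually_elim (simp add: onT_def lipschitz_circle_bound)
qed (simp add: borel_measurable_mu)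

text \<open>Product rule: |f 1| + 2 L bounds f on the circle and multiplies the variation of
  \<open>u\<close>; the variation of f adds L. It is applied with u = z and u =
  \<open>cnj z\<close>.\<close>

lemma lipschitz_unimodular_mult:
  assumes "1-lipschitz_on (sphere 0 1) u" "\<And>z. cmod z = 1 \<Longrightarrow> cmod (u z) = 1"
  shows "(cmod (f 1) + 3 * L)-lipschitz_on (sphere 0 1) (\<lambda>z. u z * f z)"
proof (rule lipschitz_onI)
  show "0 \<le> cmod (f 1) + 3 * L"
    using lipschitz_on_nonneg[OF lip] by simp
  fix w z :: complex assume wz: "w \<in> sphere 0 1" "z \<in> sphere 0 1"
  have "dist (u w * f w) (u z * f z) = cmod (u w * (f w - f z) + (u w - u z) * f z)"
    by (simp add: dist_norm algebra_simps)
  also have "\<dots> \<le> cmod (u w * (f w - f z)) + cmod ((u w - u z) * f z)"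
    by (rule norm_triangle_ineq)
  also have "\<dots> \<le> L * cmod (w - z) + cmod (w - z) * (cmod (f 1) + 2 * L)"
    using lipschitz_onD[OF lip wz] lipschitz_onD[OF assms(1) wz] lipschitz_circle_bound[of z] wz assms(2)[of w]
    by (intro add_mono) (auto simp: norm_mult dist_norm intro: mult_mono)
  finally show "dist (u w * f w) (u z * f z) \<le> (cmod (f 1) + 3 * L) * dist w z"
    by (simp add: dist_norm algebra_simps)
qed

text \<open>The numerator splits as z (f \<xi> - f z) plus \<xi> f \<xi> times the denominator.
  Cancelling the denominator needs \<xi> \<noteq> z, so z must not be an atom. The extra integral is
  the one in \<open>Phi_shift\<close>.\<close>

lemma J_id_mult:
  assumes z: "cmod z = 1" and atom: "prob {z} = 0"
  shows "J (\<lambda>z. z * f z) z = z * J f z + (LINT \<xi>|\<mu>. \<xi> * onT f \<xi>)"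
proof -
  let ?q = "\<lambda>\<xi>. (onT f \<xi> - f z) / (1 - cnj \<xi> * z)"
  have int: "integrable \<mu> (\<lambda>\<xi>. \<xi> * onT f \<xi>)"
    using integrable_L2_mult_cnj[OF L2_onT L2_cnj] by (simp add: mult.commute)
  have ne: "AE \<xi> in \<mu>. \<xi> \<noteq> z"
    by (rule AE_I[of _ _ "{z}"]) (use atom in \<open>auto simp: emeasure_eq_measure\<close>)
  have "J (\<lambda>z. z * f z) z = (LINT \<xi>|\<mu>. z * ?q \<xi> + \<xi> * onT f \<xi>)"
    unfolding J_def
  proof (rule integral_cong_AE)
    show "AE \<xi> in \<mu>. (onT (\<lambda>z. z * f z) \<xi> - z * f z) / (1 - cnj \<xi> * z) = z * ?q \<xi> + \<xi> * onT f \<xi>"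
      using AE_mu_circle ne
    proof eventually_elim
      case (elim \<xi>)
      then have "1 - cnj \<xi> * z \<noteq> 0"
        using norm_one_minus_cnj_mult[of \<xi> z] by force
      moreover have "\<xi> * cnj \<xi> = 1"
        using elim by (simp add: complex_norm_square[symmetric])
      then have "\<xi> * f \<xi> - z * f z = z * (f \<xi> - f z) + \<xi> * f \<xi> * (1 - cnj \<xi> * z)"
        by (simp add: algebra_simps flip: mult.assoc)
      ultimately show ?case
        using elim by (simp add: onT_def field_simps)
    qed
    have "onT (\<lambda>z. z * f z) = (\<lambda>\<xi>. \<xi> * onT f \<xi>)"
      by (auto simp: onT_def)
    then show "(\<lambda>\<xi>. (onT (\<lambda>z. z * f z) \<xi> - z * f z) / (1 - cnj \<xi> * z)) \<in> borel_measurable \<mu>"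
      by (simp add: borel_measurable_mu)
  qed (simp add: borel_measurable_mu)
  also have "\<dots> = z * J f z + (LINT \<xi>|\<mu>. \<xi> * onT f \<xi>)"
    using int quotient_integrable[OF z] by (simp add: J_def del: times_divide_eq_right)
  finally show ?thesis .
qed

text \<open>Both sides of the formula obey the recursion of \<open>Phi_shift\<close>, and the common
  factor z can be cancelled. The equivalence lets one climb to powers of z and descend to powers of
  \<open>cnj z\<close>.\<close>

lemma represented_id_mult: "represented (\<lambda>z. z * f z) \<longleftrightarrow> represented f"
proof -
  \<comment> \<open>A finite measure has only countably many atoms, and these form a Lebesgue null
    set.\<close>
  have "countable {z. prob {z} \<noteq> 0}"
    by (rule countable_support)
  then have "AE z in lebT. \<forall>a\<in>{z. prob {z} \<noteq> 0}. z \<noteq> a"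
    by (subst AE_ball_countable) (auto intro: AE_lebT_neq)
  then have atom: "AE z in lebT. prob {z} = 0"
    by eventually_elim auto
  have "onT (\<lambda>z. z * f z) = (\<lambda>\<xi>. \<xi> * onT f \<xi>)"
    by (auto simp: onT_def)
  then have shift: "AE z in lebT. \<Phi> (onT (\<lambda>z. z * f z)) z =
      csmul z (\<Phi> (onT f) z) + csmul (LINT \<xi>|\<mu>. \<xi> * onT f \<xi>) (B z)"
    using Phi_shift[OF L2_onT] by simp
  have "AE z in lebT. \<Phi> (onT (\<lambda>z. z * f z)) z =
      csmul (z * f z) (c z) + csmul (J (\<lambda>z. z * f z) z) (B z) \<longleftrightarrow>
      \<Phi> (onT f) z = csmul (f z) (c z) + csmul (J f z) (B z)"
    using AE_lebT_circle atom shift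
  proof eventually_elim
    case (elim z)
    have "csmul (z * f z) (c z) + csmul (J (\<lambda>z. z * f z) z) (B z) =
        csmul z (csmul (f z) (c z) + csmul (J f z) (B z)) + csmul (LINT \<xi>|\<mu>. \<xi> * onT f \<xi>) (B z)"
      using elim by (simp add: J_id_mult csmul_simps)
    moreover have "z \<noteq> 0"
      using elim by auto
    ultimately show ?case
      using elim by (simp add: csmul_cancel)
  qed
  then show ?thesis
    unfolding represented_def by (rule eventually_subst)
qed

end

section \<open>Linearity of the representation formula\<close>

lemma J_lincomb:
  assumes "L-lipschitz_on (sphere 0 1) f" "M-lipschitz_on (sphere 0 1) g" "cmod z = 1"
  shows "J (\<lambda>z. a * f z + g z) z = a * J f z + J g z"
proof -
  have "J (\<lambda>z. a * f z + g z) z = (LINT \<xi>|\<mu>. a * ((onT f \<xi> - f z) / (1 - cnj \<xi> * z))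
      + (onT g \<xi> - g z) / (1 - cnj \<xi> * z))"
    unfolding J_def
    by (rule Bochner_Integration.integral_cong) (auto simp: onT_def add_divide_distrib diff_divide_distrib algebra_simps)
  also have "\<dots> = a * J f z + J g z"
    using quotient_integrable[OF assms(1,3)] quotient_integrable[OF assms(2,3)]
    by (simp add: J_def del: times_divide_eq_right)
  finally show ?thesis .
qed

lemma Phi_onT_lincomb:
  assumes "L-lipschitz_on (sphere 0 1) f" "M-lipschitz_on (sphere 0 1) g"
  shows "AE z in lebT. \<Phi> (onT (\<lambda>z. a * f z + g z)) z = csmul a (\<Phi> (onT f) z) + \<Phi> (onT g) z"
proof -
  have "onT (\<lambda>z. a * f z + g z) = (\<lambda>\<xi>. a * onT f \<xi> + onT g \<xi>)"
    by (auto simp: onT_def)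
  then show ?thesis
    using Phi_lincomb[OF L2_onT L2_onT, OF assms] by simp
qed

lemma represented_lincomb:
  assumes "L-lipschitz_on (sphere 0 1) f" "M-lipschitz_on (sphere 0 1) g" "represented f" "represented g"
  shows "represented (\<lambda>z. a * f z + g z)"
  using Phi_onT_lincomb[OF assms(1,2), of a] assms(3,4) AE_lebT_circle
  unfolding represented_def
  by eventually_elim (simp add: J_lincomb[OF assms(1,2)] csmul_simps)

section \<open>The formula for trigonometric polynomials\<close>

lemma represented_one: "represented (\<lambda>z. 1)"
proof -
  have lip: "0-lipschitz_on (sphere 0 1) (\<lambda>z. 1 :: complex)"
    by (simp add: lipschitz_on_def)
  have "AE z in lebT. \<Phi> (onT (\<lambda>z. 1)) z = \<Phi> (\<lambda>z. 1) z"
    by (rule Phi_cong_AE[OF L2_onT[OF lip] L2_one]) (use AE_mu_circle in \<open>eventually_elim, simp add: onT_def\<close>)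
  then show ?thesis
    using Phi_one AE_lebT_circle unfolding represented_def eq2_def
    \<comment> \<open>A constant has Lipschitz constant 0, so its singular integral
      vanishes.\<close>
    by eventually_elim (use norm_J_le[OF lip] in \<open>simp add: csmul_simps\<close>)
qed

lemma represented_cong:
  assumes "\<And>z. cmod z = 1 \<Longrightarrow> f z = g z"
  shows "represented f \<longleftrightarrow> represented g"
proof -
  have "onT f = onT g"
    using assms by (auto simp: onT_def)
  then have "J f z = J g z" if "cmod z = 1" for z
    using that assms by (simp add: J_def)
  then have "AE z in lebT. \<Phi> (onT f) z = csmul (f z) (c z) + csmul (J f z) (B z) \<longleftrightarrow>
      \<Phi> (onT g) z = csmul (g z) (c z) + csmul (J g z) (B z)"
    by (intro eventually_mono[OF AE_lebT_circle]) (simp add: assms \<open>onT f = onT g\<close>)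
  then show ?thesis
    unfolding represented_def by (rule eventually_subst)
qed

text \<open>Start from 1. Powers of \<open>cnj z\<close> come from the backward shift, as z times
  the next power is the previous one on the circle; powers of z come from the forward shift. The
  Lipschitz bound travels along because each shift step requires it.\<close>

lemma represented_monomial:
  "represented (\<lambda>z. z ^ m * cnj z ^ n) \<and> (\<exists>L. L-lipschitz_on (sphere 0 1) (\<lambda>z. z ^ m * cnj z ^ n :: complex))"
proof (induction m)
  case 0
  show ?case
  proof (induction n)
    case 0
    have "0-lipschitz_on (sphere 0 1) (\<lambda>z. 1 :: complex)"
      by (simp add: lipschitz_on_def)
    then show ?case
      using represented_one by auto
  next
    case (Suc n)
    define g where "g = (\<lambda>z. cnj z * (z ^ 0 * cnj z ^ n))"
    have "1-lipschitz_on (sphere 0 1) cnj"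
      by (simp add: lipschitz_on_def dist_norm flip: complex_cnj_diff)
    with Suc obtain L where L: "L-lipschitz_on (sphere 0 1) g"
      unfolding g_def using lipschitz_unimodular_mult[of _ "\<lambda>z. z ^ 0 * cnj z ^ n" cnj] by auto
    have g: "z * g z = z ^ 0 * cnj z ^ n" if "cmod z = 1" for z
    proof -
      have "z * g z = (z * cnj z) * cnj z ^ n"
        by (simp add: g_def)
      then show ?thesis
        using that by (simp add: complex_norm_square[symmetric])
    qed
    have "represented (\<lambda>z. z * g z)"
      by (rule represented_cong[OF g, THEN iffD2]) (use Suc in auto)
    then have "represented g"
      using represented_id_mult[OF L] by simp
    then show ?case
      using L by (auto simp: g_def)
  qed
next
  case (Suc m)
  then obtain L where L: "L-lipschitz_on (sphere 0 1) (\<lambda>z. z ^ m * cnj z ^ n :: complex)"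
    by blast
  have "1-lipschitz_on (sphere 0 1) (\<lambda>z :: complex. z)"
    by (simp add: lipschitz_on_def)
  from lipschitz_unimodular_mult[OF L this] Suc show ?case
    using represented_id_mult[OF L] by (auto simp: mult.assoc)
qed

lemma represented_trig_poly:
  assumes "trig_poly p"
  shows "represented p" "\<exists>L. L-lipschitz_on (sphere 0 1) p"
proof -
  have lip0: "0-lipschitz_on (sphere 0 1) (\<lambda>z. 0 :: complex)"
    by (simp add: lipschitz_on_def)
  have lin: "(cmod a * L + M)-lipschitz_on (sphere 0 1) (\<lambda>z. a * f z + g z)"
    if "L-lipschitz_on (sphere 0 1) f" "M-lipschitz_on (sphere 0 1) g" for L M a and f g :: "complex \<Rightarrow> complex"
  proof -
    have "(cmod a * L)-lipschitz_on (sphere 0 1) (\<lambda>z. a * f z)"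
      using that(1) unfolding lipschitz_on_def dist_norm
      by (auto simp: norm_mult mult.assoc intro: mult_left_mono simp flip: right_diff_distrib)
    then show ?thesis
      using that(2) by (rule lipschitz_on_add)
  qed
  have "represented p \<and> (\<exists>L. L-lipschitz_on (sphere 0 1) p)"
    using assms
  proof induction
    case (monomial a m n)
    obtain L where L: "L-lipschitz_on (sphere 0 1) (\<lambda>z. z ^ m * cnj z ^ n :: complex)"
      using represented_monomial by blast
    \<comment> \<open>Zero is (-1) * 1 + 1; a scalar multiple is then a linear combination with
      zero.\<close>
    have "represented (\<lambda>z. 0)"
      using represented_lincomb[of 0 "\<lambda>z. 1" 0 "\<lambda>z. 1" "-1"] represented_one
      by (simp add: lipschitz_on_def)
    then show ?case
      using represented_lincomb[OF L lip0, of a] lin[OF L lip0, of a] represented_monomial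
      by (auto simp: mult.assoc)
  next
    case (add p q)
    then obtain L M where "L-lipschitz_on (sphere 0 1) p" "M-lipschitz_on (sphere 0 1) q"
      by blast
    with add.IH lin[of L p M q 1] represented_lincomb[of L p M q 1] show ?case
      by auto
  qed
  then show "represented p" "\<exists>L. L-lipschitz_on (sphere 0 1) p"
    by auto
qed

section \<open>Passage from trigonometric polynomials to C^1 functions\<close>

lemma Phi_onT_norm_le:
  assumes "L-lipschitz_on (sphere 0 1) h" "\<And>z. cmod z = 1 \<Longrightarrow> cmod (h z) \<le> e"
  shows "(LINT z|lebT. (norm (\<Phi> (onT h) z))\<^sup>2) \<le> e\<^sup>2"
proof -
  note L2 = L2_onT[OF assms(1)]
  have "complex_of_real (LINT z|lebT. (norm (\<Phi> (onT h) z))\<^sup>2) = ipL \<mu> (onT h) (onT h)"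
    using Phi_isometry[OF L2 L2] by (simp add: ip2_self)
  also have "\<dots> = complex_of_real (LINT \<xi>|\<mu>. (cmod (onT h \<xi>))\<^sup>2)"
    by (rule ipL_self)
  finally have "(LINT z|lebT. (norm (\<Phi> (onT h) z))\<^sup>2) = (LINT \<xi>|\<mu>. (cmod (onT h \<xi>))\<^sup>2)"
    by (rule of_real_eq_iff[THEN iffD1])
  also have "\<dots> \<le> (LINT \<xi>|\<mu>. e\<^sup>2)"
  proof (rule integral_mono_AE)
    show "AE \<xi> in \<mu>. (cmod (onT h \<xi>))\<^sup>2 \<le> e\<^sup>2"
      using AE_mu_circle by eventually_elim (auto simp: onT_def assms(2) intro: power_mono)
  qed (use L2 in \<open>auto simp: L2_def\<close>)
  finally show ?thesis
    using prob_space by simp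
qed

text \<open>The images of the errors tend to zero in L^2, hence a.e. along a subsequence; the
  remaining error terms tend to zero at every point of the circle where they are evaluated.\<close>

lemma represented_C1:
  assumes "C1_T f"
  shows "represented f"
proof -
  define e where "e n = inverse (real (Suc n))" for n
  have e_pos: "0 < e n" for n
    by (simp add: e_def)
  have e_lim: "e \<longlonglongrightarrow> 0"
    unfolding e_def by (rule LIMSEQ_inverse_real_of_nat)
  have "\<exists>p. trig_poly p \<and> (e n)-lipschitz_on (sphere 0 1) (\<lambda>z. f z - p z) \<and>
      (\<forall>z. cmod z = 1 \<longrightarrow> cmod (f z - p z) \<le> e n)" for n
    using C1_T_trig_poly_approx[OF assms e_pos] by metis
  then obtain p where p: "\<And>n. trig_poly (p n)"
    "\<And>n. (e n)-lipschitz_on (sphere 0 1) (\<lambda>z. f z - p n z)"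
    "\<And>n z. cmod z = 1 \<Longrightarrow> cmod (f z - p n z) \<le> e n"
    by metis
  define h where "h n z = f z - p n z" for n z
  have h: "(e n)-lipschitz_on (sphere 0 1) (h n)" "cmod z = 1 \<Longrightarrow> cmod (h n z) \<le> e n" for n z
    using p(2,3) by (simp_all add: h_def[abs_def])
  \<comment> \<open>Squared norms turn L^2 convergence into L^1 convergence, from which an a.e.
    convergent subsequence is extracted.\<close>
  define u where "u n z = (norm (\<Phi> (onT (h n)) z))\<^sup>2" for n z
  have "integrable lebT (u n)" for n
    unfolding u_def by (intro L2_pair_norm_integrable Phi_L2 L2_onT[OF h(1)])
  moreover have "(\<lambda>n. LINT z|lebT. norm (u n z)) \<longlonglongrightarrow> 0"
  proof (rule tendsto_sandwich[of "\<lambda>_. 0" _ _ "\<lambda>n. (e n)\<^sup>2"])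
    show "\<forall>\<^sub>F n in sequentially. (LINT z|lebT. norm (u n z)) \<le> (e n)\<^sup>2"
      using Phi_onT_norm_le[OF h] by (simp add: u_def)
    show "(\<lambda>n. (e n)\<^sup>2) \<longlonglongrightarrow> 0"
      using tendsto_power[OF e_lim, of 2] by simp
  qed simp_all
  ultimately obtain r where r: "strict_mono r" "AE z in lebT. (\<lambda>n. u (r n) z) \<longlonglongrightarrow> 0"
    using tendsto_L1_AE_subseq by blast
  define D where "D z = \<Phi> (onT f) z - (csmul (f z) (c z) + csmul (J f z) (B z))" for z
  \<comment> \<open>The formula holds for \<open>p n\<close>, so only the contributions of
    \<open>h n\<close> remain in \<open>D\<close>. Countably many n leave one common null set;
    \<open>D\<close> itself is independent of n, so the limit forces it to vanish.\<close>
  have "AE z in lebT. \<forall>n. norm (D z) \<le> norm (\<Phi> (onT (h n)) z) + e n * (norm (c z) + norm (B z))"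
    unfolding AE_all_countable
  proof
    fix n
    obtain L where L: "L-lipschitz_on (sphere 0 1) (p n)"
      using represented_trig_poly p(1) by blast
    have f: "(\<lambda>z. 1 * h n z + p n z) = f"
      by (simp add: h_def)
    show "AE z in lebT. norm (D z) \<le> norm (\<Phi> (onT (h n)) z) + e n * (norm (c z) + norm (B z))"
      using Phi_onT_lincomb[OF h(1)[of n] L, of 1] represented_trig_poly(1)[OF p(1)[of n]] AE_lebT_circle
      unfolding represented_def f
    proof eventually_elim
      case (elim z)
      have "D z = \<Phi> (onT (h n)) z - (csmul (h n z) (c z) + csmul (J (h n) z) (B z))"
        using J_lincomb[OF h(1)[of n] L elim(3), of 1] elim(1,2) unfolding f
        by (simp add: D_def csmul_simps h_def)
      then have "norm (D z) \<le> norm (\<Phi> (onT (h n)) z) + (norm (csmul (h n z) (c z)) + norm (csmul (J (h n) z) (B z)))"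
        by (simp only: order_trans[OF norm_triangle_ineq4 add_left_mono[OF norm_triangle_ineq]])
      also have "norm (csmul (h n z) (c z)) \<le> e n * norm (c z)"
        using h(2) elim by (simp add: norm_csmul mult_right_mono)
      also have "norm (csmul (J (h n) z) (B z)) \<le> e n * norm (B z)"
        using norm_J_le[OF h(1)] elim by (simp add: norm_csmul mult_right_mono)
      finally show ?case
        by (simp add: distrib_left)
    qed
  qed
  with r(2) have "AE z in lebT. D z = 0"
  proof eventually_elim
    case (elim z)
    have "(\<lambda>n. norm (\<Phi> (onT (h (r n))) z)) \<longlonglongrightarrow> 0"
      using tendsto_real_sqrt[OF elim(1)] by (simp add: u_def)
    moreover have "(\<lambda>n. e (r n)) \<longlonglongrightarrow> 0"
      using LIMSEQ_subseq_LIMSEQ[OF e_lim r(1)] by (simp add: o_def)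
    ultimately have "(\<lambda>n. norm (\<Phi> (onT (h (r n))) z) + e (r n) * (norm (c z) + norm (B z)))
        \<longlonglongrightarrow> 0 + 0 * (norm (c z) + norm (B z))"
      by (intro tendsto_intros)
    then have "norm (D z) \<le> 0 + 0 * (norm (c z) + norm (B z))"
      by (rule Lim_bounded2) (use elim(2) in auto)
    then show ?case
      by simp
  qed
  then show ?thesis
    unfolding represented_def by eventually_elim (simp add: D_def)
qed

end

theorem theorem4p1:
  fixes \<mu> :: "complex measure" and \<gamma> :: complex
    and c c1 :: v2 and \<Phi> :: "(complex \<Rightarrow> complex) \<Rightarrow> v2"
  defines "K \<equiv> model_space (thetaB \<mu> \<gamma>) (DeltaB \<mu> \<gamma>)"
  assumes mu: "prob_space \<mu>" "sets \<mu> = sets (borel :: complex measure)"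
      "emeasure \<mu> (sphere 0 1) = 1"
    and gam: "cmod \<gamma> < 1"
    and c: "c \<in> defect_star K (model_op K)" "norm2 c = 1"
    and c1: "c1 \<in> defect K (model_op K)" "norm2 c1 = 1"
    and Phi_unitary: "unitary_to \<mu> K \<Phi>"
    and Phi_intertw: "\<forall>f. L2 \<mu> f \<longrightarrow> eq2 (\<Phi> (U\<gamma> \<mu> \<gamma> f)) (model_op K (\<Phi> f))"
    and Phi_b: "eq2 (\<Phi> (\<lambda>\<xi>. 1)) c"
    and Phi_b1: "eq2 (\<Phi> (\<lambda>\<xi>. cnj \<xi>)) c1"
  shows "\<forall>f. C1_T f \<longrightarrow>
    (AE z in lebT.
       \<Phi> (onT f) z =
         (let J = (LINT \<xi>|\<mu>. (onT f \<xi> - f z) / (1 - cnj \<xi> * z));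
              A = c z;
              B = (fst (c z) - z * fst (c1 z), snd (c z) - z * snd (c1 z))
          in (fst A * f z + fst B * J, snd A * f z + snd B * J)))"
proof -
  interpret model_intertwiner \<mu> K \<Phi> c c1
  proof (rule model_intertwiner.intro)
    show "L2_pair x" if "x \<in> K" for x
      using that by (simp add: K_def model_space_def L2_pair_def H2_def closDeltaL2_def)
    \<comment> \<open>Orthogonality to b1 makes the rank-one term of \<open>U\<gamma>\<close>
      zero.\<close>
    show "eq2 (\<Phi> (\<lambda>\<xi>. \<xi> * f \<xi>)) (model_op K (\<Phi> f))" if "L2 \<mu> f" "ipL \<mu> f cnj = 0" for f
      using Phi_intertw that by (auto simp: U\<gamma>_def)
  qed (rule mu Phi_unitary Phi_b Phi_b1)+
  show ?thesis
    using represented_C1 unfolding represented_def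
    by (simp add: J_def B_def csmul_def Let_def plus_prod_def minus_prod_def mult.commute)
qed

end
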